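(* For all $m\ge1$, $\Delta A(m)\in\{0,1\}$ and $\Delta B(m)\in\{0,1\}$. Moreover, for every $r\ge0$, \[ A(u_r)=B(u_r)=a_r,\qquad A(v_r)=B(v_r)=2a_r, \] and \[ B(u_r+1)=a_r+1,\quad A(v_r-1)=2a_r-1,\quad B(v_r-1)=2a_r,\quad A(u_{r+1}-1)=a_{r+1},\quad B(u_{r+1}-1)=a_{r+1}-1. \]
   Context: Let $\widetilde Q(1)=\widetilde Q(2)=1$ and $\widetilde Q(n)=\widetilde Q(n-\widetilde Q(n-1))+\widetilde Q(n-\widetilde Q(n-2))+(-1)^n$ for $n\ge3$ (this is well defined, and all values are odd). Put $A(m):=(\widetilde Q(2m-1)+1)/2$, $B(m):=(\widetilde Q(2m)+1)/2$, $\Delta A(m):=A(m+1)-A(m)$ and $\Delta B(m):=B(m+1)-B(m)$. For $r\ge0$ let $a_r:=(2\cdot4^{r+1}+1)/3$, $u_r:=2a_r-r-2$ and $v_r:=4a_r-r-2$. *)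

theory Defs
  imports Main
begin

text \<open>
  The sequence Q~, indexed from 1. It is a nested recursion, so the definition carries the guard
  that both inner indices lie in \<open>{1..<n}\<close>. Where the guard fails the value is the junk
  constant -1. This constant is odd, so that all values are odd (\<open>odd_Qt\<close>), and negative, so that
  positivity at \<open>n\<close> forces the guard, and hence the plain recursion, to hold at \<open>n\<close>
  (\<open>Qt_rec\<close>). The value at 0 is irrelevant.
\<close>

function Qt :: "nat \<Rightarrow> int" where
  "Qt n =
     (if n \<le> 2 then 1
      else let i = int n - Qt (n - 1); j = int n - Qt (n - 2) in
        if 1 \<le> i \<and> i < int n \<and> 1 \<le> j \<and> j < int n
        then Qt (nat i) + Qt (nat j) + (- 1) ^ n
        else - 1)"
  by auto
termination
  by (relation "measure id") auto

declare Qt.simps [simp del]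

lemma Qt_1: "Qt 1 = 1" and Qt_2: "Qt 2 = 1"
  by (simp_all add: Qt.simps)

lemma Qt_rec:
  assumes "3 \<le> n" and "0 < Qt n"
  shows "int n - Qt (n - 1) \<in> {1..<int n}"
    and "int n - Qt (n - 2) \<in> {1..<int n}"
    and "Qt n = Qt (nat (int n - Qt (n - 1))) + Qt (nat (int n - Qt (n - 2))) + (- 1) ^ n"
  using assms Qt.simps[of n] by (auto simp: Let_def split: if_splits)

lemma odd_Qt: "odd (Qt n)"
proof (induction n rule: less_induct)
  case (less n)
  show ?case
    using less.IH by (subst Qt.simps) (auto simp: Let_def)
qed

definition A :: "nat \<Rightarrow> int" where
  "A m = (Qt (2 * m - 1) + 1) div 2"

definition B :: "nat \<Rightarrow> int" where
  "B m = (Qt (2 * m) + 1) div 2"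

lemma two_A: "2 * A m = Qt (2 * m - 1) + 1" and two_B: "2 * B m = Qt (2 * m) + 1"
  using odd_Qt[of "2 * m - 1"] odd_Qt[of "2 * m"] unfolding A_def B_def by presburger+

definition \<Delta>A :: "nat \<Rightarrow> int" where
  "\<Delta>A m = A (m + 1) - A m"

definition \<Delta>B :: "nat \<Rightarrow> int" where
  "\<Delta>B m = B (m + 1) - B m"

definition a_seq :: "nat \<Rightarrow> nat" where
  "a_seq r = (2 * 4 ^ (r + 1) + 1) div 3"

definition u_seq :: "nat \<Rightarrow> nat" where
  "u_seq r = 2 * a_seq r - r - 2"

definition v_seq :: "nat \<Rightarrow> nat" where
  "v_seq r = 4 * a_seq r - r - 2"

text \<open>The division is exact and no subtraction is truncated.\<close>

lemma three_a_seq: "3 * a_seq r = 2 * 4 ^ (r + 1) + 1"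
proof -
  have "3 dvd 2 * 4 ^ (r + 1) + (1::nat)"
  proof (induction r)
    case (Suc r)
    then obtain k :: nat where "2 * 4 ^ (r + 1) + 1 = 3 * k" ..
    then have "2 * 4 ^ (Suc r + 1) + 1 = 3 * (4 * k - 1)" by simp
    then show ?case by simp
  qed simp
  then show ?thesis by (simp add: a_seq_def)
qed

lemma a_seq_ge: "r + 3 \<le> a_seq r"
proof -
  have "3 * (r + 3) \<le> 2 * 4 ^ (r + 1) + (1::nat)"
    by (induction r) auto
  then show ?thesis using three_a_seq[of r] by simp
qed

lemma int_u_seq: "int (u_seq r) = 2 * int (a_seq r) - int r - 2"
  and int_v_seq: "int (v_seq r) = 4 * int (a_seq r) - int r - 2"
  using a_seq_ge[of r] by (simp_all add: u_seq_def v_seq_def)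

end

theory Submission imports Defs begin

text \<open>
  Halving the recursion gives
  \<open>A(m+1) = B(m+1-B(m)) + B(m+1-A(m)) - 1\<close> and \<open>B(m+1) = A(m+2-A(m+1)) + A(m+2-B(m))\<close>.
  Two regimes alternate: on \<open>[u\<^sub>r, v\<^sub>r]\<close> the sum \<open>A(m) + B(m) - m\<close> is constant, and on
  \<open>[v\<^sub>r - 1, u\<^sub>r\<^sub>+\<^sub>1)\<close> the sum \<open>A(m+1) + B(m) - m\<close> is constant. In either regime exactly one of the
  two pointers of the driving recursion advances at each step, so the new increment is a single
  increment read off the preceding regime, and the complementarity of the increments there
  yields the complementarity here. Both pointers sweep the whole preceding regime, and the known
  increments at its end force them to arrive there together, which fixes the values at the
  next \<open>v\<^sub>r\<close> or \<open>u\<^sub>r\<^sub>+\<^sub>1\<close>.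
\<close>

section \<open>Halved recursions on integer indices\<close>

definition \<alpha> :: "int \<Rightarrow> int" where "\<alpha> i = A (nat i)"
definition \<beta> :: "int \<Rightarrow> int" where "\<beta> i = B (nat i)"

text \<open>The bounds say that both inner indices lie in \<open>{1..<n}\<close>. In contrast to
  \<open>Qt_rec\<close>, the guard is obtained from the two preceding values, which an induction
  already controls.\<close>

lemma Qt_step:
  assumes "3 \<le> n" "1 \<le> Qt (n - 1)" "Qt (n - 1) < int n" "1 \<le> Qt (n - 2)" "Qt (n - 2) < int n"
  shows "Qt n = Qt (nat (int n - Qt (n - 1))) + Qt (nat (int n - Qt (n - 2))) + (- 1) ^ n"
  using assms by (subst Qt.simps) (auto simp: Let_def)

lemma Qt_odd_index: "1 \<le> i \<Longrightarrow> Qt (nat (2 * i - 1)) = 2 * \<alpha> i - 1"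
  using two_A[of "nat i"] by (simp add: \<alpha>_def nat_diff_distrib nat_mult_distrib)

lemma Qt_even_index: "1 \<le> i \<Longrightarrow> Qt (nat (2 * i)) = 2 * \<beta> i - 1"
  using two_B[of "nat i"] by (simp add: \<beta>_def nat_mult_distrib)

text \<open>An odd index minus odd values is even, so both inner terms come from
  \<open>\<beta>\<close>; the \<open>- 1\<close> collects the sign and the halving offsets.\<close>

lemma \<alpha>_rec:
  assumes "1 \<le> m" "1 \<le> \<alpha> m" "\<alpha> m \<le> m" "1 \<le> \<beta> m" "\<beta> m \<le> m"
  shows "\<alpha> (m + 1) = \<beta> (m + 1 - \<beta> m) + \<beta> (m + 1 - \<alpha> m) - 1"
proof -
  define n where "n = nat (2 * m + 1)"
  have n: "3 \<le> n" "int n = 2 * m + 1" "odd n"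
    using assms(1) by (auto simp: n_def even_nat_iff)
  have n1: "n - 1 = nat (2 * m)" and n2: "n - 2 = nat (2 * m - 1)"
    using assms(1) by (auto simp: n_def)
  have Q1: "Qt (n - 1) = 2 * \<beta> m - 1" and Q2: "Qt (n - 2) = 2 * \<alpha> m - 1"
    unfolding n1 n2 using assms(1) by (simp_all add: Qt_odd_index Qt_even_index)
  have "Qt n = Qt (nat (2 * (m + 1 - \<beta> m))) + Qt (nat (2 * (m + 1 - \<alpha> m))) - 1"
  proof -
    have "int n - Qt (n - 1) = 2 * (m + 1 - \<beta> m)" "int n - Qt (n - 2) = 2 * (m + 1 - \<alpha> m)"
      using n Q1 Q2 by simp_all
    moreover have "Qt n = Qt (nat (int n - Qt (n - 1))) + Qt (nat (int n - Qt (n - 2))) + (- 1) ^ n"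
      by (rule Qt_step) (use n assms Q1 Q2 in linarith)+
    ultimately show ?thesis using n(3) by (simp only: power_minus_odd power_one) simp
  qed
  moreover have "Qt n = 2 * \<alpha> (m + 1) - 1"
    using Qt_odd_index[of "m + 1"] assms(1) by (simp add: n_def algebra_simps)
  ultimately show ?thesis
    using Qt_even_index[of "m + 1 - \<beta> m"] Qt_even_index[of "m + 1 - \<alpha> m"] assms by simp
qed

text \<open>Now both inner indices are odd, and the sign \<open>+1\<close> cancels the offset.
  \<open>\<beta> m\<close> may reach \<open>m + 1\<close>, since
  \<open>m + 2 - \<beta> m = 1\<close> is still a legal index.\<close>

lemma \<beta>_rec:
  assumes "1 \<le> m" "1 \<le> \<alpha> (m + 1)" "\<alpha> (m + 1) \<le> m + 1" "1 \<le> \<beta> m" "\<beta> m \<le> m + 1"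
  shows "\<beta> (m + 1) = \<alpha> (m + 2 - \<alpha> (m + 1)) + \<alpha> (m + 2 - \<beta> m)"
proof -
  define n where "n = nat (2 * m + 2)"
  have n: "3 \<le> n" "int n = 2 * m + 2" "even n"
    using assms(1) by (auto simp: n_def even_nat_iff)
  have n1: "n - 1 = nat (2 * (m + 1) - 1)" and n2: "n - 2 = nat (2 * m)"
    using assms(1) by (auto simp: n_def)
  have Q1: "Qt (n - 1) = 2 * \<alpha> (m + 1) - 1" and Q2: "Qt (n - 2) = 2 * \<beta> m - 1"
    unfolding n1 n2 using assms(1) by (simp_all only: Qt_odd_index Qt_even_index)
  have "Qt n = Qt (nat (2 * (m + 2 - \<alpha> (m + 1)) - 1)) + Qt (nat (2 * (m + 2 - \<beta> m) - 1)) + 1"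
  proof -
    have "int n - Qt (n - 1) = 2 * (m + 2 - \<alpha> (m + 1)) - 1"
      "int n - Qt (n - 2) = 2 * (m + 2 - \<beta> m) - 1"
      using n Q1 Q2 by simp_all
    moreover have "Qt n = Qt (nat (int n - Qt (n - 1))) + Qt (nat (int n - Qt (n - 2))) + (- 1) ^ n"
      by (rule Qt_step) (use n assms Q1 Q2 in linarith)+
    ultimately show ?thesis using n(3) by (simp only: power_minus_even power_one)
  qed
  moreover have "Qt n = 2 * \<beta> (m + 1) - 1"
    using Qt_even_index[of "m + 1"] assms(1) by (simp add: n_def algebra_simps)
  ultimately show ?thesis
    using Qt_odd_index[of "m + 2 - \<alpha> (m + 1)"] Qt_odd_index[of "m + 2 - \<beta> m"] assms by simp
qed

section \<open>The two regimes as predicates\<close>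

lemma unit_steps_bounds:
  fixes f :: "int \<Rightarrow> int"
  assumes "\<And>k. p \<le> k \<Longrightarrow> k < q \<Longrightarrow> f (k + 1) - f k \<in> {0, 1}"
    and "p \<le> i" "i \<le> j" "j \<le> q"
  shows "f i \<le> f j \<and> f j - f i \<le> j - i"
  using assms(3,4)
proof (induction j rule: int_ge_induct)
  case (step j)
  with assms(1)[of j] assms(2) show ?case by auto
qed simp

text \<open>Both pointers of the next regime start by reading \<open>\<alpha> (u + 1)\<close>; the
  values at \<open>v\<close>, \<open>v - 1\<close>, \<open>v - 2\<close> decide how that regime
  ends. The sum supplies the values of \<open>\<beta>\<close>.\<close>

definition U_phase :: "int \<Rightarrow> int \<Rightarrow> bool" where
  "U_phase r a \<longleftrightarrow>
    (let u = 2 * a - r - 2; v = 4 * a - r - 2 in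
      (\<forall>m. u \<le> m \<longrightarrow> m \<le> v \<longrightarrow> \<alpha> m + \<beta> m = m + r + 2) \<and>
      (\<forall>m. u \<le> m \<longrightarrow> m < v \<longrightarrow> \<alpha> (m + 1) - \<alpha> m \<in> {0, 1}) \<and>
      \<alpha> u = a \<and> \<alpha> (u + 1) = a \<and> \<alpha> v = 2 * a \<and> \<alpha> (v - 1) = 2 * a - 1 \<and> \<alpha> (v - 2) = 2 * a - 2)"

text \<open>Here \<open>u'\<close> is the next value of \<open>u\<close>, obtained from \<open>r + 1\<close> and \<open>4 * a - 1\<close>.\<close>

definition V_phase :: "int \<Rightarrow> int \<Rightarrow> bool" where
  "V_phase r a \<longleftrightarrow>
    (let v = 4 * a - r - 2; u' = 8 * a - r - 5 in
      (\<forall>m. v - 1 \<le> m \<longrightarrow> m \<le> u' - 1 \<longrightarrow> \<alpha> (m + 1) + \<beta> m = m + r + 3) \<and>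
      (\<forall>m. v - 1 \<le> m \<longrightarrow> m < u' \<longrightarrow> \<beta> (m + 1) - \<beta> m \<in> {0, 1}) \<and>
      \<beta> (v - 1) = 2 * a \<and> \<beta> v = 2 * a \<and>
      \<beta> (u' - 1) = 4 * a - 2 \<and> \<beta> u' = 4 * a - 1 \<and>
      \<alpha> (u' - 1) = 4 * a - 1)"

section \<open>From constant \<open>\<alpha> m + \<beta> m - m\<close> to constant
  \<open>\<alpha> (m + 1) + \<beta> m - m\<close>\<close>

text \<open>Here \<open>\<beta>\<close> drives: it is the sum of \<open>\<alpha>\<close> at two
  pointers that start together at \<open>u + 1\<close>, have index sum \<open>m - r\<close>, and
  stop at \<open>v\<close> and \<open>v - 1\<close>.\<close>

lemma V_phase_if_U_phase:
  assumes U: "U_phase r a" and r: "0 \<le> r" and a: "r + 3 \<le> a"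
  shows "V_phase r a"
proof -
  define u v u' where "u = 2 * a - r - 2" and "v = 4 * a - r - 2" and "u' = 8 * a - r - 5"
  note uv = u_def v_def u'_def
  have sum: "\<alpha> m + \<beta> m = m + r + 2" if "u \<le> m" "m \<le> v" for m
    using U that unfolding U_phase_def Let_def uv by blast
  have \<Delta>: "\<alpha> (m + 1) - \<alpha> m \<in> {0, 1}" if "u \<le> m" "m < v" for m
    using U that unfolding U_phase_def Let_def uv by blast
  have ends: "\<alpha> u = a" "\<alpha> (u + 1) = a" "\<alpha> v = 2 * a" "\<alpha> (v - 1) = 2 * a - 1" "\<alpha> (v - 2) = 2 * a - 2"
    using U unfolding U_phase_def Let_def uv by blast+
  have mono: "\<alpha> i \<le> \<alpha> j \<and> \<alpha> j - \<alpha> i \<le> j - i" if "u \<le> i" "i \<le> j" "j \<le> v" for i j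
    using unit_steps_bounds[of u v \<alpha>] \<Delta> that by blast
  have \<beta>_ends: "\<beta> (u + 1) = a + 1" "\<beta> v = 2 * a" "\<beta> (v - 1) = 2 * a"
    using sum[of "u + 1"] sum[of v] sum[of "v - 1"] ends a r by (auto simp: uv)
  have \<alpha>_after: "\<alpha> (v + 1) = 2 * a + 1"
    using \<alpha>_rec[of v] ends \<beta>_ends a r by (simp add: uv algebra_simps)
  \<comment> \<open>The last conjunct of \<open>J\<close> remembers that while \<open>\<beta>\<close> keeps rising the idle pointer
    \<open>m + 1 - \<beta> (m - 1)\<close> stays put, so the increment it read last was a 1.\<close>
  define J where "J m \<longleftrightarrow>
      \<alpha> m + \<beta> (m - 1) = m + r + 2 \<and> \<alpha> (m + 1) + \<beta> m = m + r + 3 \<and>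
      \<beta> m - \<beta> (m - 1) \<in> {0, 1} \<and>
      \<beta> (m - 1) \<ge> 2 * a \<and> \<alpha> m \<ge> 2 * a \<and>
      m + 1 - \<beta> (m - 1) \<le> v \<and> m + 1 - \<alpha> m \<le> v - 1 \<and>
      \<beta> m = \<alpha> (m + 1 - \<alpha> m) + \<alpha> (m + 1 - \<beta> (m - 1)) \<and>
      (\<beta> m - \<beta> (m - 1) = 1 \<longrightarrow>
        \<alpha> (m + 1 - \<beta> (m - 1)) - \<alpha> (m - \<beta> (m - 1)) = 1)" for m
  have base: "J v"
    using ends \<beta>_ends \<alpha>_after a r unfolding J_def
    by (auto simp: uv algebra_simps)
  have step: "J (m + 1)" if m: "v \<le> m" "m < u'" and J: "J m" for m
  proof -
    define x y D D' where "x = m + 1 - \<beta> (m - 1)" and "y = m + 1 - \<alpha> m"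
      and "D = \<beta> m - \<beta> (m - 1)" and "D' = \<beta> (m + 1) - \<beta> m"
    have s0: "\<alpha> m + \<beta> (m - 1) = m + r + 2" and s1: "\<alpha> (m + 1) + \<beta> m = m + r + 3"
      and D: "D = 0 \<or> D = 1" and ge: "\<beta> (m - 1) \<ge> 2 * a" "\<alpha> m \<ge> 2 * a"
      and le: "x \<le> v" "y \<le> v - 1" and \<beta>m: "\<beta> m = \<alpha> y + \<alpha> x"
      and track: "D = 1 \<Longrightarrow> \<alpha> x - \<alpha> (x - 1) = 1"
      using J unfolding J_def x_def y_def D_def by auto
    have xy: "x + y = m - r" "u + 1 \<le> x" "u + 1 \<le> y"
      using s0 ge m by (auto simp: x_def y_def uv)
    \<comment> \<open>For \<open>D = 1\<close> the pointer \<open>y\<close> moves on and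
      \<open>x\<close> idles; for \<open>D = 0\<close> the roles swap.\<close>
    have idx: "m + 2 - \<alpha> (m + 1) = y + D" "m + 2 - \<beta> m = x + 1 - D"
      "m + 1 - \<beta> m = x - D" "m + 1 - \<alpha> m = y" "m + 2 - \<beta> (m + 1) = x + 1 - D - D'"
      using s0 s1 by (auto simp: x_def y_def D_def D'_def)
    have \<beta>m1: "\<beta> (m + 1) = \<alpha> (y + D) + \<alpha> (x + 1 - D)"
      using \<beta>_rec[of m] s0 s1 ge D m a r unfolding idx by (auto simp: D_def uv)
    have \<alpha>m1: "\<alpha> (m + 1) = \<beta> (x - D) + \<beta> y - 1"
      using \<alpha>_rec[of m] s0 s1 ge D m a r unfolding idx by (auto simp: D_def uv)
    \<comment> \<open>With \<open>x = v\<close> and \<open>D = 0\<close>, \<open>\<alpha> y\<close>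
      would be one too small for unit steps to reach \<open>\<alpha> v = 2 * a\<close>.\<close>
    have x_lt: "x < v" if "D = 0"
    proof (rule ccontr)
      assume "\<not> x < v"
      with le have x: "x = v" by simp
      then have "\<beta> m = \<alpha> y + 2 * a" "m + 1 - \<beta> m = v" "v + y = m - r"
        using \<beta>m ends xy that by (auto simp: D_def x_def)
      then show False
        using mono[of y v] le xy ends by (auto simp: uv)
    qed
    \<comment> \<open>With \<open>y = v - 1\<close> and \<open>D = 1\<close>, the recursion would
      force \<open>\<alpha> x = 2 * a > \<alpha> (v - 1)\<close> although
      \<open>x \<le> v - 1\<close>.\<close>
    have y_lt: "y < v - 1" if "D = 1"
    proof (rule ccontr)
      assume "\<not> y < v - 1"
      with le have y: "y = v - 1" by simp
      then have "x \<le> v - 1" using xy m by (simp add: uv)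
      moreover have "\<beta> m = 2 * a - 1 + \<alpha> x" "m + 1 - (\<beta> m - 1) = x"
        using \<beta>m ends y that by (auto simp: D_def x_def)
      ultimately show False
        using mono[of x "v - 1"] y xy ends by (auto simp: uv)
    qed
    have D': "D' = 0 \<or> D' = 1"
      using D \<beta>m \<beta>m1 \<Delta>[of x] \<Delta>[of y] x_lt y_lt xy by (auto simp: D'_def)
    have "\<alpha> (m + 1 + 1) = \<beta> (m + 1 + 1 - \<beta> (m + 1)) + \<beta> (m + 1 + 1 - \<alpha> (m + 1)) - 1"
      using s0 s1 ge D D' m a r by (intro \<alpha>_rec) (auto simp: D_def D'_def uv)
    then have \<alpha>m2: "\<alpha> (m + 2) = \<beta> (x + 1 - D - D') + \<beta> (y + D) - 1"
      by (simp only: add.assoc one_add_one idx)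
    \<comment> \<open>\<open>\<alpha>\<close> must rise by \<open>1 - D'\<close>, the complementary
      increment at the moving pointer. For \<open>D = 1\<close> the other term must also stay at
      \<open>\<beta> (x - 1)\<close>: this is clear if \<open>D' = 1\<close> and is
      \<open>track\<close> if \<open>D' = 0\<close>.\<close>
    have s2: "\<alpha> (m + 2) + \<beta> (m + 1) = m + r + 4"
      using D
    proof
      assume D0: "D = 0"
      then show ?thesis
        using D' s1 \<alpha>m1 \<alpha>m2 \<beta>m \<beta>m1 sum[of x] sum[of "x + 1"] x_lt xy
        by (auto simp: D'_def)
    next
      assume D1: "D = 1"
      then show ?thesis
        using D' s1 \<alpha>m1 \<alpha>m2 \<beta>m \<beta>m1 sum[of y] sum[of "y + 1"] sum[of x] sum[of "x - 1"] y_lt xy le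
          track by (auto simp: D'_def)
    qed
    have track': "D' = 1 \<Longrightarrow> \<alpha> (x + 1 - D) - \<alpha> (x - D) = 1"
      using D track \<beta>m \<beta>m1 by (auto simp: D'_def)
    have "D' \<in> {0, 1}" "\<beta> m \<ge> 2 * a" "\<alpha> (m + 1) \<ge> 2 * a" "x + 1 - D \<le> v" "y + D \<le> v - 1"
      using D D' ge le x_lt y_lt s0 s1 by (auto simp: D_def)
    moreover have norm: "m + 1 - 1 = m" "m + 1 + 1 = m + 2" by simp_all
    ultimately show ?thesis
      using s1 s2 \<beta>m1 track' unfolding J_def norm idx D'_def[symmetric] by simp
  qed
  have J: "J m" if "v \<le> m" "m \<le> u'" for m
    using that by (induction m rule: int_ge_induct) (auto intro: base step)
  have Jsum: "\<alpha> (m + 1) + \<beta> m = m + r + 3" if "v - 1 \<le> m" "m \<le> u' - 1" for m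
    using J[of "m + 1"] that by (simp add: J_def)
  have J\<Delta>: "\<beta> (m + 1) - \<beta> m \<in> {0, 1}" if "v - 1 \<le> m" "m < u'" for m
  proof -
    have "J (m + 1)" using that by (intro J) auto
    then show ?thesis unfolding J_def add_diff_cancel_right' by blast
  qed
  have "v \<le> u' - 2" using a r by (simp add: uv)
  \<comment> \<open>At \<open>m = u'\<close> the pointers sum to \<open>2 * v - 1\<close>, so their
    bounds \<open>v\<close> and \<open>v - 1\<close> are both attained.\<close>
  have last: "\<alpha> u' = 4 * a - 1" "\<beta> (u' - 1) = 4 * a - 2" "\<beta> u' = 4 * a - 1"
  proof -
    note Ju = J[of u', unfolded J_def]
    have *: "u' + 1 - \<beta> (u' - 1) = v" "u' + 1 - \<alpha> u' = v - 1"
      using Ju \<open>v \<le> u' - 2\<close> by (auto simp: uv)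
    then show "\<alpha> u' = 4 * a - 1" "\<beta> (u' - 1) = 4 * a - 2" by (auto simp: uv)
    show "\<beta> u' = 4 * a - 1" using Ju \<open>v \<le> u' - 2\<close> unfolding * ends by simp
  qed
  \<comment> \<open>Otherwise the pointers for \<open>\<beta> (u' - 2)\<close> stand at
    \<open>v - 2\<close> and \<open>v - 1\<close> in some order and give \<open>4 * a - 3\<close>,
    against the required \<open>4 * a - 2\<close>.\<close>
  have "\<alpha> (u' - 1) = 4 * a - 1"
  proof (rule ccontr)
    assume neq: "\<alpha> (u' - 1) \<noteq> 4 * a - 1"
    note J1 = J[of "u' - 1", unfolded J_def] and J2 = J[of "u' - 2", unfolded J_def]
    have \<alpha>1: "\<alpha> (u' - 1) = 4 * a - 2" "\<beta> (u' - 2) = 4 * a - 2"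
      using J1 J[of u', unfolded J_def] neq \<open>v \<le> u' - 2\<close> last by (auto simp: uv)
    have "(\<alpha> (u' - 2) = 4 * a - 2 \<and> \<beta> (u' - 3) = 4 * a - 3) \<or>
          (\<alpha> (u' - 2) = 4 * a - 3 \<and> \<beta> (u' - 3) = 4 * a - 2)"
      using J2 \<alpha>1 \<open>v \<le> u' - 2\<close> by (auto simp: uv)
    moreover have "\<beta> (u' - 2) = \<alpha> (u' - 1 - \<alpha> (u' - 2)) + \<alpha> (u' - 1 - \<beta> (u' - 3))"
      using J2 \<open>v \<le> u' - 2\<close> by simp
    moreover have "u' - 1 - (4 * a - 2) = v - 2" "u' - 1 - (4 * a - 3) = v - 1"
      by (simp_all add: uv)
    ultimately have "\<beta> (u' - 2) = \<alpha> (v - 2) + \<alpha> (v - 1)" by auto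
    then show False using \<alpha>1 ends by simp
  qed
  with Jsum J\<Delta> \<beta>_ends last show ?thesis
    unfolding V_phase_def Let_def uv by blast
qed

section \<open>Return to constant \<open>\<alpha> m + \<beta> m - m\<close>\<close>

text \<open>The roles swap: \<open>\<alpha>\<close> is driven by two pointers into
  \<open>\<beta>\<close>, which start together at \<open>s\<close> and stop at \<open>u\<close> and
  \<open>u + 1\<close>.\<close>

lemma U_phase_if_V_phase:
  assumes V: "V_phase r a\<^sub>0" and r: "0 \<le> r" and a\<^sub>0: "r + 3 \<le> a\<^sub>0"
  shows "U_phase (r + 1) (4 * a\<^sub>0 - 1)"
proof -
  \<comment> \<open>\<open>a\<close>, \<open>u\<close>, \<open>v\<close> belong to the new regime
    with \<open>r + 1\<close>; \<open>s\<close> is the old \<open>v\<close> minus 1.\<close>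
  define a s u v where "a = 4 * a\<^sub>0 - 1" and "s = 4 * a\<^sub>0 - r - 3"
    and "u = 8 * a\<^sub>0 - r - 5" and "v = 16 * a\<^sub>0 - r - 7"
  note uv = a_def s_def u_def v_def
  have V_sum: "\<alpha> (m + 1) + \<beta> m = m + r + 3" if "s \<le> m" "m \<le> u - 1" for m
    using V that unfolding V_phase_def Let_def uv by simp
  have V_\<Delta>: "\<beta> (m + 1) - \<beta> m \<in> {0, 1}" if "s \<le> m" "m < u" for m
    using V that unfolding V_phase_def Let_def uv by simp
  have ends: "\<beta> s = 2 * a\<^sub>0" "\<beta> (s + 1) = 2 * a\<^sub>0" "\<beta> (u - 1) = a - 1" "\<beta> u = a"
    using V unfolding V_phase_def Let_def uv by simp_all
  have \<alpha>_ends: "\<alpha> (s + 1) = 2 * a\<^sub>0" "\<alpha> u = a"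
    using V_sum[of s] V_sum[of "u - 1"] ends a\<^sub>0 r by (auto simp: uv)
  have start: "u + 1 - a = s" "u + 2 - a = s + 1" "1 \<le> a" "a \<le> u" "2 * (2 * a\<^sub>0) = a + 1"
    "2 * a = u + r + 3"
    using a\<^sub>0 r by (auto simp: uv)
  have \<alpha>_after: "\<alpha> (u + 1) = a"
    using \<alpha>_rec[of u] ends \<alpha>_ends start by simp
  have \<beta>_after: "\<beta> (u + 1) = a + 1"
    using \<beta>_rec[of u] ends \<alpha>_ends \<alpha>_after start by simp
  \<comment> \<open>The pointer \<open>y\<close> can reach \<open>u + 1\<close>, so the known sum
    and increments are extended by one place.\<close>
  have sum: "\<alpha> (m + 1) + \<beta> m = m + r + 3" if "s \<le> m" "m \<le> u" for m
    using V_sum[of m] that \<alpha>_after ends by (cases "m = u") (auto simp: uv)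
  have \<Delta>: "\<beta> (m + 1) - \<beta> m \<in> {0, 1}" if "s \<le> m" "m < u + 1" for m
    using V_\<Delta>[of m] that \<beta>_after ends by (cases "m = u") auto
  have mono: "\<beta> i \<le> \<beta> j \<and> \<beta> j - \<beta> i \<le> j - i" if "s \<le> i" "i \<le> j" "j \<le> u + 1" for i j
    using unit_steps_bounds[of s "u + 1" \<beta>] \<Delta> that by blast
  \<comment> \<open>As for \<open>J\<close>, the last conjunct records the increment last read by the idle pointer.\<close>
  define I where "I m \<longleftrightarrow>
      \<alpha> (m - 1) + \<beta> (m - 1) = m + r + 2 \<and> \<alpha> m + \<beta> m = m + r + 3 \<and>
      \<alpha> m - \<alpha> (m - 1) \<in> {0, 1} \<and>
      a \<le> \<alpha> (m - 1) \<and> a \<le> \<beta> (m - 1) \<and> a + 1 \<le> \<beta> m \<and>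
      \<beta> m \<le> 2 * a \<and> \<alpha> m \<le> 2 * a \<and> (\<alpha> m = 2 * a \<longrightarrow> m = v) \<and>
      \<alpha> m = \<beta> (m - \<beta> (m - 1)) + \<beta> (m - \<alpha> (m - 1)) - 1 \<and>
      \<beta> m = \<alpha> (m + 1 - \<alpha> m) + \<alpha> (m + 1 - \<beta> (m - 1)) \<and>
      (\<alpha> m - \<alpha> (m - 1) = 1 \<longrightarrow>
        \<beta> (m + 1 - \<alpha> m) - \<beta> (m - \<alpha> m) = 1)" for m
  have base: "I (u + 1)"
  proof -
    have norm: "u + 1 - 1 = u" "u + 1 + 1 = u + 2" by simp_all
    show ?thesis
      using start(3-)
      unfolding I_def norm ends \<alpha>_ends \<alpha>_after \<beta>_after start(1,2) by simp
  qed
  have step: "I (m + 1)" if m: "u + 1 \<le> m" "m < v" and I: "I m" for m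
  proof -
    define x y w w' where "x = m + 1 - \<beta> m" and "y = m + 1 - \<alpha> m"
      and "w = \<alpha> m - \<alpha> (m - 1)" and "w' = \<alpha> (m + 1) - \<alpha> m"
    have y_pred: "m - \<alpha> m = y - 1" by (simp add: y_def)
    have s0: "\<alpha> (m - 1) + \<beta> (m - 1) = m + r + 2" and s1: "\<alpha> m + \<beta> m = m + r + 3"
      and w: "w = 0 \<or> w = 1"
      and bounds: "a \<le> \<alpha> (m - 1)" "a \<le> \<beta> (m - 1)" "a + 1 \<le> \<beta> m" "\<beta> m \<le> 2 * a" "\<alpha> m < 2 * a"
      and \<alpha>m: "\<alpha> m = \<beta> (m - \<beta> (m - 1)) + \<beta> (m - \<alpha> (m - 1)) - 1"
      and \<beta>m: "\<beta> m = \<alpha> y + \<alpha> (m + 1 - \<beta> (m - 1))"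
      and track: "w = 1 \<Longrightarrow> \<beta> y - \<beta> (y - 1) = 1"
      using I m unfolding I_def y_def[symmetric] w_def[symmetric] y_pred by auto
    have xy: "x = \<alpha> m - r - 2" "y = \<beta> m - r - 2"
      using s1 by (auto simp: x_def y_def)
    have xy_bounds: "s \<le> x" "x \<le> u" "s + 1 \<le> y" "y \<le> u + 1" "w = 1 \<Longrightarrow> s + 1 \<le> x"
      using bounds w s0 s1 unfolding xy by (auto simp: uv w_def)
    \<comment> \<open>Unlike \<open>D\<close>, \<open>w\<close> describes the move just made:
      \<open>w = 1\<close> means that \<open>x\<close> advanced and \<open>y\<close> idled.\<close>
    have idx: "m - \<beta> (m - 1) = x - w" "m - \<alpha> (m - 1) = y - 1 + w"
      "m + 1 - \<beta> (m - 1) = x + 1 - w"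
      "m + 2 - \<alpha> (m + 1) = y + 1 - w'" "m + 2 - \<beta> m = x + 1"
      using s0 s1 by (auto simp: x_def y_def w_def w'_def)
    have \<alpha>m1: "\<alpha> (m + 1) = \<beta> x + \<beta> y - 1"
      using \<alpha>_rec[of m] s0 s1 w bounds m a\<^sub>0 r unfolding x_def[symmetric] y_def[symmetric]
      by (auto simp: w_def uv)
    have w': "w' = 0 \<or> w' = 1"
      using w \<alpha>m \<alpha>m1 \<Delta>[of "x - 1"] \<Delta>[of "y - 1"] xy_bounds unfolding idx by (auto simp: w'_def)
    \<comment> \<open>At \<open>\<beta> m = 2 * a\<close> the pointer \<open>y\<close> is at its
      limit \<open>u + 1\<close>; the unit-step bound from \<open>x\<close> then forces
      \<open>\<alpha>\<close> to rise, so \<open>\<beta>\<close> can stay.\<close>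
    have w'1: "w' = 1" if "\<beta> m = 2 * a"
    proof -
      have "y = u + 1" using that xy by (simp add: uv)
      then show ?thesis
        using mono[of x "u + 1"] xy_bounds \<alpha>m1 \<beta>_after w' xy that by (auto simp: w'_def uv)
    qed
    have "\<beta> (m + 1) = \<alpha> (m + 2 - \<alpha> (m + 1)) + \<alpha> (m + 2 - \<beta> m)"
      using s0 s1 bounds w w' m a\<^sub>0 r by (intro \<beta>_rec) (auto simp: w_def w'_def uv)
    then have \<beta>m1: "\<beta> (m + 1) = \<alpha> (y + 1 - w') + \<alpha> (x + 1)"
      unfolding idx .
    have y_le: "y \<le> u" if "w' = 0"
      using w'1 that bounds xy by (cases "\<beta> m = 2 * a") (auto simp: uv)
    \<comment> \<open>\<open>\<beta>\<close> must rise by \<open>1 - w'\<close>. For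
      \<open>w = 0\<close> only the \<open>y\<close> term changes; for \<open>w = 1\<close> the
      \<open>x\<close> term supplies the rise and \<open>track\<close> keeps the \<open>y\<close>
      term fixed.\<close>
    have s2: "\<alpha> (m + 1) + \<beta> (m + 1) = m + r + 4"
      using w
    proof
      assume w0: "w = 0"
      then show ?thesis
        using w' s1 \<alpha>m \<alpha>m1 \<beta>m \<beta>m1 sum[of y] sum[of "y - 1"] y_le xy_bounds unfolding idx
        by (auto simp: w'_def)
    next
      assume w1: "w = 1"
      then show ?thesis
        using w' s1 \<alpha>m \<alpha>m1 \<beta>m \<beta>m1 sum[of y] sum[of "y - 1"] sum[of x] sum[of "x - 1"] y_le xy_bounds
          track unfolding idx
        by (auto simp: w'_def)
    qed
    \<comment> \<open>Reaching \<open>2 * a\<close> needs \<open>x = u\<close> and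
      \<open>\<beta> y = a + 1\<close>; as \<open>\<beta> u = a\<close>, this puts \<open>y\<close>
      at \<open>u + 1\<close> and fixes \<open>m\<close>.\<close>
    have top: "m + 1 = v" if "\<alpha> (m + 1) = 2 * a"
    proof -
      have x: "\<alpha> m = 2 * a - 1" "x = u"
        using that w' bounds xy by (auto simp: w'_def uv)
      then have "\<beta> y = a + 1" using that \<alpha>m1 ends by simp
      then have "y = u + 1"
        using mono[of y u] xy_bounds ends by (cases "y \<le> u") auto
      then show ?thesis using x xy s1 by (simp add: uv)
    qed
    have track': "w' = 1 \<Longrightarrow> \<beta> y - \<beta> (y - 1) = 1"
      using w track \<alpha>m \<alpha>m1 unfolding idx by (auto simp: w'_def)
    have "a \<le> \<alpha> m" "a \<le> \<beta> m" "a + 1 \<le> \<beta> (m + 1)" "\<beta> (m + 1) \<le> 2 * a" "\<alpha> (m + 1) \<le> 2 * a"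
      using w w' w'1 bounds s1 s2 by (cases "\<beta> m = 2 * a"; auto simp: w_def w'_def)+
    moreover have norm: "m + 1 - 1 = m" "m + 1 + 1 = m + 2" "m + 1 - \<alpha> (m + 1) = y - w'"
      by (simp_all add: y_def w'_def)
    moreover have "y - w' = y - 1" "y + 1 - w' = y" if "w' = 1"
      using that by simp_all
    ultimately show ?thesis
      using s1 s2 w' top \<alpha>m1 \<beta>m1 track'
      unfolding I_def norm idx x_def[symmetric] y_def[symmetric] w'_def[symmetric] by auto
  qed
  have I: "I m" if "u + 1 \<le> m" "m \<le> v" for m
    using that by (induction m rule: int_ge_induct) (auto intro: base step)
  have I_sum: "\<alpha> m + \<beta> m = m + (r + 1) + 2" if "u \<le> m" "m \<le> v" for m
    using I[of m] that ends \<alpha>_ends by (cases "m = u") (auto simp: I_def uv)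
  have I_\<Delta>: "\<alpha> (m + 1) - \<alpha> m \<in> {0, 1}" if "u \<le> m" "m < v" for m
  proof -
    have "I (m + 1)" using that by (intro I) auto
    then show ?thesis unfolding I_def add_diff_cancel_right' by blast
  qed
  have "u + 1 \<le> v - 3" using a\<^sub>0 r by (simp add: uv)
  note Iv = I[of v, unfolded I_def] and I1 = I[of "v - 1", unfolded I_def]
    and I2 = I[of "v - 2", unfolded I_def]
  \<comment> \<open>At \<open>v\<close> the sum is \<open>4 * a\<close> with both terms at most
    \<open>2 * a\<close>; at \<open>v - 1\<close> it is one less, and \<open>\<alpha>\<close> cannot
    yet be \<open>2 * a\<close>.\<close>
  have \<alpha>v: "\<alpha> v = 2 * a" using Iv \<open>u + 1 \<le> v - 3\<close> by (auto simp: uv)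
  have \<alpha>v1: "\<alpha> (v - 1) = 2 * a - 1" using I1 \<open>u + 1 \<le> v - 3\<close> by (auto simp: uv)
  \<comment> \<open>Otherwise \<open>\<alpha> (v - 2) = 2 * a - 1\<close>, yet its pointers read
    \<open>\<beta>\<close> at \<open>u - 1\<close> and \<open>u\<close>, giving only
    \<open>2 * a - 2\<close>.\<close>
  have "\<alpha> (v - 2) = 2 * a - 2"
  proof (rule ccontr)
    assume "\<alpha> (v - 2) \<noteq> 2 * a - 2"
    then have 2: "\<alpha> (v - 2) = 2 * a - 1" "\<beta> (v - 2) = 2 * a - 1"
      using I2 \<open>u + 1 \<le> v - 3\<close> by (auto simp: uv)
    have "(\<alpha> (v - 3) = 2 * a - 2 \<and> \<beta> (v - 3) = 2 * a - 1) \<or>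
          (\<alpha> (v - 3) = 2 * a - 1 \<and> \<beta> (v - 3) = 2 * a - 2)"
      using I2 2 \<open>u + 1 \<le> v - 3\<close> by (auto simp: uv)
    moreover have "\<alpha> (v - 2) = \<beta> (v - 2 - \<beta> (v - 3)) + \<beta> (v - 2 - \<alpha> (v - 3)) - 1"
      using I2 \<open>u + 1 \<le> v - 3\<close> by simp
    moreover have "v - 2 - (2 * a - 1) = u - 1" "v - 2 - (2 * a - 2) = u"
      by (simp_all add: uv)
    ultimately have "\<alpha> (v - 2) = \<beta> (u - 1) + \<beta> u - 1" by auto
    then show False using 2 ends by simp
  qed
  moreover have "2 * a - (r + 1) - 2 = u" "4 * a - (r + 1) - 2 = v" by (simp_all add: uv)
  ultimately show ?thesis
    using I_sum I_\<Delta> \<alpha>_ends \<alpha>_after \<alpha>v \<alpha>v1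
    unfolding U_phase_def a_def[symmetric] Let_def by presburger
qed

section \<open>Initial values and the first regime\<close>

text \<open>Index 20 is where \<open>\<beta> 10\<close> is read, and 10 is the value of
  \<open>v\<close> for \<open>r = 0\<close>, \<open>a = 3\<close>.\<close>

lemma Qt_initial:
  "Qt 3 = 1" "Qt 4 = 3" "Qt 5 = 3" "Qt 6 = 3" "Qt 7 = 5" "Qt 8 = 5" "Qt 9 = 5" "Qt 10 = 7"
  "Qt 11 = 5" "Qt 12 = 9" "Qt 13 = 7" "Qt 14 = 9" "Qt 15 = 7" "Qt 16 = 11" "Qt 17 = 9"
  "Qt 18 = 11" "Qt 19 = 11" "Qt 20 = 11"
proof -
  show 3: "Qt 3 = 1" using Qt_1 Qt_2 by (subst Qt.simps) simp
  show 4: "Qt 4 = 3" using Qt_1 Qt_2 3 by (subst Qt.simps) simp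
  show 5: "Qt 5 = 3" using Qt_1 Qt_2 3 4 by (subst Qt.simps) simp
  show 6: "Qt 6 = 3" using Qt_1 Qt_2 3 4 5 by (subst Qt.simps) simp
  note q = Qt_1 Qt_2 3 4 5 6
  show 7: "Qt 7 = 5" using q by (subst Qt.simps) simp
  show 8: "Qt 8 = 5" using q 7 by (subst Qt.simps) simp
  show 9: "Qt 9 = 5" using q 7 8 by (subst Qt.simps) simp
  show 10: "Qt 10 = 7" using q 7 8 9 by (subst Qt.simps) simp
  note q = q 7 8 9 10
  show 11: "Qt 11 = 5" using q by (subst Qt.simps) simp
  show 12: "Qt 12 = 9" using q 11 by (subst Qt.simps) simp
  show 13: "Qt 13 = 7" using q 11 12 by (subst Qt.simps) simp
  show 14: "Qt 14 = 9" using q 11 12 13 by (subst Qt.simps) simp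
  note q = q 11 12 13 14
  show 15: "Qt 15 = 7" using q by (subst Qt.simps) simp
  show 16: "Qt 16 = 11" using q 15 by (subst Qt.simps) simp
  show 17: "Qt 17 = 9" using q 15 16 by (subst Qt.simps) simp
  show 18: "Qt 18 = 11" using q 15 16 17 by (subst Qt.simps) simp
  note q = q 15 16 17 18
  show 19: "Qt 19 = 11" using q by (subst Qt.simps) simp
  show 20: "Qt 20 = 11" using q 19 by (subst Qt.simps) simp
qed

lemma \<alpha>_initial:
  "\<alpha> 1 = 1" "\<alpha> 2 = 1" "\<alpha> 3 = 2" "\<alpha> 4 = 3" "\<alpha> 5 = 3"
  "\<alpha> 6 = 3" "\<alpha> 7 = 4" "\<alpha> 8 = 4" "\<alpha> 9 = 5" "\<alpha> 10 = 6"
  and \<beta>_initial: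
  "\<beta> 1 = 1" "\<beta> 2 = 2" "\<beta> 3 = 2" "\<beta> 4 = 3" "\<beta> 5 = 4"
  "\<beta> 6 = 5" "\<beta> 7 = 5" "\<beta> 8 = 6" "\<beta> 9 = 6" "\<beta> 10 = 6"
  using Qt_1 Qt_2 by (simp_all add: \<alpha>_def \<beta>_def A_def B_def Qt_initial)

lemma U_phase_0: "U_phase 0 3"
proof -
  have m: "m = 4 \<or> m = 5 \<or> m = 6 \<or> m = 7 \<or> m = 8 \<or> m = 9 \<or> m = 10" if "4 \<le> m" "m \<le> 10" for m :: int
    using that by linarith
  have "\<alpha> m + \<beta> m = m + 2" if "4 \<le> m" "m \<le> 10" for m
    using m[OF that] by (elim disjE) (simp_all add: \<alpha>_initial \<beta>_initial)
  moreover have "\<alpha> (m + 1) - \<alpha> m = 0 \<or> \<alpha> (m + 1) - \<alpha> m = 1" if "4 \<le> m" "m < 10" for m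
    using m[OF that(1) less_imp_le[OF that(2)]] that by (elim disjE) (simp_all add: \<alpha>_initial)
  ultimately show ?thesis
    by (simp add: U_phase_def \<alpha>_initial)
qed

section \<open>All regimes and the final assembly\<close>

lemma a_seq_0: "a_seq 0 = 3"
  by (simp add: a_seq_def)

lemma a_seq_Suc: "int (a_seq (Suc r)) = 4 * int (a_seq r) - 1"
  using three_a_seq[of r] three_a_seq[of "Suc r"] by simp

lemma U_phase_a_seq: "U_phase (int r) (int (a_seq r))"
  and V_phase_a_seq: "V_phase (int r) (int (a_seq r))"
proof -
  have VU: "V_phase (int r) (int (a_seq r))" if "U_phase (int r) (int (a_seq r))" for r
    using V_phase_if_U_phase[OF that] a_seq_ge[of r] by simp
  show U: "U_phase (int r) (int (a_seq r))"
  proof (induction r)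
    case 0
    show ?case using U_phase_0 by (simp add: a_seq_0)
  next
    case (Suc r)
    show ?case
      using U_phase_if_V_phase[OF VU[OF Suc]] a_seq_ge[of r] by (simp add: a_seq_Suc add.commute)
  qed
  show "V_phase (int r) (int (a_seq r))" by (rule VU[OF U])
qed

theorem theorem4p8:
  "(\<forall>m\<ge>1. \<Delta>A m \<in> {0, 1} \<and> \<Delta>B m \<in> {0, 1}) \<and>
   (\<forall>r.
      A (u_seq r) = int (a_seq r) \<and> B (u_seq r) = int (a_seq r) \<and>
      A (v_seq r) = 2 * int (a_seq r) \<and> B (v_seq r) = 2 * int (a_seq r) \<and>
      B (u_seq r + 1) = int (a_seq r) + 1 \<and>
      A (v_seq r - 1) = 2 * int (a_seq r) - 1 \<and>
      B (v_seq r - 1) = 2 * int (a_seq r) \<and>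
      A (u_seq (r + 1) - 1) = int (a_seq (r + 1)) \<and>
      B (u_seq (r + 1) - 1) = int (a_seq (r + 1)) - 1)"
proof (intro conjI allI impI)
  fix r
  define a u v where "a = int (a_seq r)" and "u = 2 * a - int r - 2" and "v = 4 * a - int r - 2"
  have a: "int r + 3 \<le> a" using a_seq_ge[of r] by (simp add: a_def)
  have nat_u: "u_seq r = nat u" "u_seq r + 1 = nat (u + 1)"
    and nat_v: "v_seq r = nat v" "v_seq r - 1 = nat (v - 1)"
    and nat_u': "u_seq (r + 1) - 1 = nat (8 * a - int r - 5 - 1)"
    using int_u_seq[of r] int_v_seq[of r] int_u_seq[of "Suc r"] a_seq_Suc[of r] a
    by (auto simp: a_def u_def v_def)
  have a': "int (a_seq (r + 1)) = 4 * a - 1" by (simp add: a_seq_Suc a_def)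
  have U: "\<alpha> u = a" "\<alpha> (u + 1) = a" "\<alpha> v = 2 * a" "\<alpha> (v - 1) = 2 * a - 1"
    "\<And>m. u \<le> m \<Longrightarrow> m \<le> v \<Longrightarrow> \<alpha> m + \<beta> m = m + int r + 2"
    using U_phase_a_seq[of r] unfolding U_phase_def Let_def a_def u_def v_def by blast+
  have V: "\<beta> (v - 1) = 2 * a" "\<beta> v = 2 * a"
    "\<beta> (8 * a - int r - 5 - 1) = 4 * a - 2" "\<alpha> (8 * a - int r - 5 - 1) = 4 * a - 1"
    using V_phase_a_seq[of r] unfolding V_phase_def Let_def a_def u_def v_def by blast+
  have \<beta>u: "\<beta> u = a" "\<beta> (u + 1) = a + 1"
    using U(5)[of u] U(5)[of "u + 1"] U(1-4) a by (auto simp: u_def v_def)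
  show "A (u_seq r) = int (a_seq r)" "B (u_seq r) = int (a_seq r)"
    "A (v_seq r) = 2 * int (a_seq r)" "B (v_seq r) = 2 * int (a_seq r)"
    "B (u_seq r + 1) = int (a_seq r) + 1"
    "A (v_seq r - 1) = 2 * int (a_seq r) - 1" "B (v_seq r - 1) = 2 * int (a_seq r)"
    "A (u_seq (r + 1) - 1) = int (a_seq (r + 1))"
    "B (u_seq (r + 1) - 1) = int (a_seq (r + 1)) - 1"
    using U V \<beta>u unfolding nat_u(2) nat_v(2)
    unfolding nat_u(1) nat_v(1) nat_u' a' \<alpha>_def \<beta>_def a_def[symmetric] by simp_all
next
  \<comment> \<open>The increments below \<open>u_seq r\<close> are handled by induction on
    \<open>r\<close>, each step adding one regime of either kind.\<close>
  have \<Delta>: "\<alpha> (k + 1) - \<alpha> k \<in> {0, 1} \<and> \<beta> (k + 1) - \<beta> k \<in> {0, 1}"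
    if "1 \<le> k" "k < 2 * int (a_seq r) - int r - 2" for k r
    using that
  proof (induction r)
    case 0
    then have "k = 1 \<or> k = 2 \<or> k = 3" by (auto simp: a_seq_0)
    then show ?case by (elim disjE) (simp_all add: \<alpha>_initial \<beta>_initial)
  next
    case (Suc r)
    define a u v u' where "a = int (a_seq r)" and "u = 2 * a - int r - 2"
      and "v = 4 * a - int r - 2" and "u' = 8 * a - int r - 5"
    note uv = u_def v_def u'_def
    have k: "k < u'" using Suc.prems by (simp add: a_seq_Suc a_def uv)
    have a: "int r + 3 \<le> a" using a_seq_ge[of r] by (simp add: a_def)
    have U: "\<And>m. u \<le> m \<Longrightarrow> m \<le> v \<Longrightarrow> \<alpha> m + \<beta> m = m + int r + 2"
      "\<And>m. u \<le> m \<Longrightarrow> m < v \<Longrightarrow> \<alpha> (m + 1) - \<alpha> m \<in> {0, 1}"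
      using U_phase_a_seq[of r] unfolding U_phase_def Let_def a_def uv by blast+
    have V: "\<And>m. v - 1 \<le> m \<Longrightarrow> m \<le> u' - 1 \<Longrightarrow> \<alpha> (m + 1) + \<beta> m = m + int r + 3"
      "\<And>m. v - 1 \<le> m \<Longrightarrow> m < u' \<Longrightarrow> \<beta> (m + 1) - \<beta> m \<in> {0, 1}"
      using V_phase_a_seq[of r] unfolding V_phase_def Let_def a_def uv by blast+
    \<comment> \<open>From \<open>v\<close> on, the increment of \<open>\<alpha>\<close> at
      \<open>k\<close> is complementary to that of \<open>\<beta>\<close> at \<open>k - 1\<close>,
      which is why the second regime begins at \<open>v - 1\<close>.\<close>
    consider "k < u" | "u \<le> k" "k < v" | "v \<le> k" by linarith
    then show ?case
    proof cases
      case 1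
      with Suc show ?thesis by (simp add: a_def u_def)
    next
      case 2
      with U(1)[of k] U(1)[of "k + 1"] U(2)[of k] show ?thesis by auto
    next
      case 3
      with V(1)[of k] V(1)[of "k - 1"] V(2)[of k] V(2)[of "k - 1"] k show ?thesis by auto
    qed
  qed
  fix m :: nat
  assume "1 \<le> m"
  \<comment> \<open>The choice \<open>r = m\<close> suffices, as \<open>u_seq m\<close> already
    exceeds \<open>m\<close>.\<close>
  moreover have "int m < 2 * int (a_seq m) - int m - 2"
    using a_seq_ge[of m] by simp
  ultimately show "\<Delta>A m \<in> {0, 1}" "\<Delta>B m \<in> {0, 1}"
    using \<Delta>[of "int m" m] by (simp_all add: \<Delta>A_def \<Delta>B_def \<alpha>_def \<beta>_def nat_add_distrib)
qed

end
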